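(* Let $k$ be a field, $\mathfrak{L}$ a Leibniz algebra over $k$, $E$ a $k$-vector space and $\pi:E\to\mathfrak{L}$ a surjective linear map with $\mathfrak{g}=\mathrm{Ker}(\pi)$. Then $$\mathbb{GHL}^2(\mathfrak{L},\mathfrak{g}) = \bigsqcup_{[-,-]_{\mathfrak{g}}} \mathbb{HL}^2\bigl(\mathfrak{L},(\mathfrak{g},[-,-]_{\mathfrak{g}})\bigr),$$ where the coproduct on the right-hand side is in the category of sets (disjoint union), over all possible Leibniz algebra structures $[-,-]_{\mathfrak{g}}$ on the vector space $\mathfrak{g}$.
   Context: All vector spaces and (bi)linear maps are over an arbitrary field $k$. A Leibniz algebra is a vector space with a bilinear bracket satisfying $[x,[y,z]] = [[x,y],z] - [[x,z],y]$. Crossed systems: a crossed system of a Leibniz algebra $\mathfrak{L}$ by a vector space $\mathfrak{g}$ is a quadruple $(\triangleleft,\triangleright,f,[-,-]_{\mathfrak{g}})$ of bilinear maps $\triangleleft : \mathfrak{g}\times\mathfrak{L}\to\mathfrak{g}$, $\triangleright : \mathfrak{L}\times\mathfrak{g}\to\mathfrak{g}$, $f : \mathfrak{L}\times\mathfrak{L}\to\mathfrak{g}$, $[-,-]_{\mathfrak{g}} : \mathfrak{g}\times\mathfrak{g}\to\mathfrak{g}$ such that $\mathfrak{g}\times\mathfrak{L}$ with the bracket $\{(g,x),(h,y)\} := ([g,h]_{\mathfrak{g}} + x\triangleright h + g\triangleleft y + f(x,y), [x,y])$ is a Leibniz algebra (in particular $(\mathfrak{g},[-,-]_{\mathfrak{g}})$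 is then a Leibniz algebra). $\mathcal{CS}(\mathfrak{L},\mathfrak{g})$ is the set of all of them. Relation $\approx$: $(\triangleleft,\triangleright,f,[-,-]_{\mathfrak{g}}) \approx (\triangleleft',\triangleright',f',[-,-]'_{\mathfrak{g}})$ iff $[-,-]_{\mathfrak{g}} = [-,-]'_{\mathfrak{g}}$ and there is a linear map $r:\mathfrak{L}\to\mathfrak{g}$ such that for all $g\in\mathfrak{g}$, $x,y\in\mathfrak{L}$: (i) $g\triangleleft x = g\triangleleft' x + [g,r(x)]_{\mathfrak{g}}$; (ii) $x\triangleright g = x\triangleright' g + [r(x),g]_{\mathfrak{g}}$; (iii) $f(x,y) = f'(x,y) + [r(x),r(y)]_{\mathfrak{g}} - r([x,y]) + x\triangleright' r(y) + r(x)\triangleleft' y$. This is an equivalence relation and $\mathbb{GHL}^2(\mathfrak{L},\mathfrak{g}) := \mathcal{CS}(\mathfrak{L},\mathfrak{g})/\approx$. Local version: for a fixed Leibniz algebra structure $[-,-]_{\mathfrak{g}}$ on $\mathfrak{g}$, a local crossed system is a triple $(\triangleleft,\triangleright,f)$ such that $(\triangleleft,\triangleright,f,[-,-]_{\mathfrak{g}})\in\mathcal{CS}(\mathfrak{L},\mathfrak{g})$; two local crossed systems are related by $\approx_l$ if there is a linear map $r:\mathfrak{L}\to\mathfrak{g}$ satisfying (i)-(iii). $\mathbb{HL}^2(\mathfrak{L},(\mathfrak{g},[-,-]_{\mathfrak{g}}))$ is the quotient of the set of local crossed systems by the equivalence relation $\approx_l$. The equality is the canonical identification sending the $\approx_l$-class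 of $(\triangleleft,\triangleright,f)$ in the component indexed by $[-,-]_{\mathfrak{g}}$ to the $\approx$-class of $(\triangleleft,\triangleright,f,[-,-]_{\mathfrak{g}})$. *)

theory Defs
  imports "HOL-Analysis.Product_Vector" "HOL-Library.FuncSet"
begin

text \<open>
  Vector spaces are given by a scaling operation \<open>s\<close> on an additive group together with a
  subspace \<open>V\<close> as carrier (\<open>V = UNIV\<close> for the whole type).  A map \<open>A \<times> B \<rightarrow> C\<close> between carriers is
  an element of \<open>A \<times> B \<rightarrow>\<^sub>E C\<close>, so that each such map is represented by exactly one HOL function.
\<close>

definition bilinear_on ::
  "('k::field \<Rightarrow> 'a::ab_group_add \<Rightarrow> 'a) \<Rightarrow> 'a set \<Rightarrow> ('k \<Rightarrow> 'b::ab_group_add \<Rightarrow> 'b) \<Rightarrow> 'b set \<Rightarrow>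
   ('k \<Rightarrow> 'c::ab_group_add \<Rightarrow> 'c) \<Rightarrow> 'c set \<Rightarrow> ('a \<times> 'b \<Rightarrow> 'c) \<Rightarrow> bool"
  where "bilinear_on sa A sb B sc C m \<longleftrightarrow>
    m \<in> A \<times> B \<rightarrow>\<^sub>E C \<and>
    (\<forall>a\<in>A. \<forall>a'\<in>A. \<forall>b\<in>B. m (a + a', b) = m (a, b) + m (a', b)) \<and>
    (\<forall>a\<in>A. \<forall>b\<in>B. \<forall>b'\<in>B. m (a, b + b') = m (a, b) + m (a, b')) \<and>
    (\<forall>t. \<forall>a\<in>A. \<forall>b\<in>B. m (sa t a, b) = sc t (m (a, b))) \<and>
    (\<forall>t. \<forall>a\<in>A. \<forall>b\<in>B. m (a, sb t b) = sc t (m (a, b)))"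

definition leibniz_algebra_on ::
  "('k::field \<Rightarrow> 'a::ab_group_add \<Rightarrow> 'a) \<Rightarrow> 'a set \<Rightarrow> ('a \<times> 'a \<Rightarrow> 'a) \<Rightarrow> bool"
  where "leibniz_algebra_on s V br \<longleftrightarrow>
    vector_space s \<and> module.subspace s V \<and> bilinear_on s V s V s V br \<and>
    (\<forall>x\<in>V. \<forall>y\<in>V. \<forall>z\<in>V. br (x, br (y, z)) = br (br (x, y), z) - br (br (x, z), y))"

text \<open>
  A quadruple \<open>(lhd, rhd, f, br)\<close> stands for \<open>(\<triangleleft>, \<triangleright>, f, [-,-])\<close>.  Throughout, the Leibniz algebra
  \<open>\<LL>\<close> is the whole type \<open>'l\<close> with scaling \<open>sL\<close> and bracket \<open>brL\<close>, and the vector space \<open>\<gg>\<close> is the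
  subspace \<open>V\<close> of \<open>'e\<close> with scaling \<open>sE\<close>.
\<close>

type_synonym ('l, 'e) local_system =
  "('e \<times> 'l \<Rightarrow> 'e) \<times> ('l \<times> 'e \<Rightarrow> 'e) \<times> ('l \<times> 'l \<Rightarrow> 'e)"

type_synonym ('l, 'e) system =
  "('e \<times> 'l \<Rightarrow> 'e) \<times> ('l \<times> 'e \<Rightarrow> 'e) \<times> ('l \<times> 'l \<Rightarrow> 'e) \<times> ('e \<times> 'e \<Rightarrow> 'e)"

definition crossed_bracket ::
  "('l \<times> 'l \<Rightarrow> 'l) \<Rightarrow> 'e::ab_group_add set \<Rightarrow> ('l, 'e) system \<Rightarrow> ('e \<times> 'l) \<times> ('e \<times> 'l) \<Rightarrow> 'e \<times> 'l"
  where "crossed_bracket brL V = (\<lambda>(lhd, rhd, f, br).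
    restrict (\<lambda>((g, x), (h, y)). (br (g, h) + rhd (x, h) + lhd (g, y) + f (x, y), brL (x, y)))
      ((V \<times> UNIV) \<times> (V \<times> UNIV)))"

definition crossed_systems ::
  "('k::field \<Rightarrow> 'l::ab_group_add \<Rightarrow> 'l) \<Rightarrow> ('l \<times> 'l \<Rightarrow> 'l) \<Rightarrow>
   ('k \<Rightarrow> 'e::ab_group_add \<Rightarrow> 'e) \<Rightarrow> 'e set \<Rightarrow> ('l, 'e) system set"
  where "crossed_systems sL brL sE V = {(lhd, rhd, f, br).
    bilinear_on sE V sL UNIV sE V lhd \<and>
    bilinear_on sL UNIV sE V sE V rhd \<and>
    bilinear_on sL UNIV sL UNIV sE V f \<and>
    bilinear_on sE V sE V sE V br \<and>
    leibniz_algebra_on (module_prod.scale sE sL) (V \<times> UNIV) (crossed_bracket brL V (lhd, rhd, f, br))}"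

text \<open>
  The three compatibility conditions only; linearity of \<open>r\<close> and \<open>range r \<subseteq> V\<close>, i.e. that \<open>r\<close> is a
  linear map \<open>\<LL> \<rightarrow> \<gg>\<close>, are required where this predicate is used.  The last condition evaluates
  \<open>\<triangleright>'\<close> and \<open>\<triangleleft>'\<close> of the second system at \<open>r\<close>.
\<close>

definition cohomologous_via ::
  "('l \<times> 'l \<Rightarrow> 'l) \<Rightarrow> 'e::ab_group_add set \<Rightarrow> ('e \<times> 'e \<Rightarrow> 'e) \<Rightarrow> ('l \<Rightarrow> 'e) \<Rightarrow>
   ('l, 'e) local_system \<Rightarrow> ('l, 'e) local_system \<Rightarrow> bool"
  where "cohomologous_via brL V br r = (\<lambda>(lhd, rhd, f) (lhd', rhd', f').
    (\<forall>g\<in>V. \<forall>x. lhd (g, x) = lhd' (g, x) + br (g, r x)) \<and>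
    (\<forall>g\<in>V. \<forall>x. rhd (x, g) = rhd' (x, g) + br (r x, g)) \<and>
    (\<forall>x y. f (x, y) = f' (x, y) + br (r x, r y) - r (brL (x, y)) + rhd' (x, r y) + lhd' (r x, y)))"

definition system_rel ::
  "('k::field \<Rightarrow> 'l::ab_group_add \<Rightarrow> 'l) \<Rightarrow> ('l \<times> 'l \<Rightarrow> 'l) \<Rightarrow>
   ('k \<Rightarrow> 'e::ab_group_add \<Rightarrow> 'e) \<Rightarrow> 'e set \<Rightarrow> ('l, 'e) system rel"
  where "system_rel sL brL sE V = {((lhd, rhd, f, br), (lhd', rhd', f', br')).
    (lhd, rhd, f, br) \<in> crossed_systems sL brL sE V \<and>
    (lhd', rhd', f', br') \<in> crossed_systems sL brL sE V \<and>
    br = br' \<and>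
    (\<exists>r. Vector_Spaces.linear sL sE r \<and> range r \<subseteq> V \<and>
         cohomologous_via brL V br r (lhd, rhd, f) (lhd', rhd', f'))}"

definition GHL2 ::
  "('k::field \<Rightarrow> 'l::ab_group_add \<Rightarrow> 'l) \<Rightarrow> ('l \<times> 'l \<Rightarrow> 'l) \<Rightarrow>
   ('k \<Rightarrow> 'e::ab_group_add \<Rightarrow> 'e) \<Rightarrow> 'e set \<Rightarrow> ('l, 'e) system set set"
  where "GHL2 sL brL sE V = crossed_systems sL brL sE V // system_rel sL brL sE V"

definition local_crossed_systems ::
  "('k::field \<Rightarrow> 'l::ab_group_add \<Rightarrow> 'l) \<Rightarrow> ('l \<times> 'l \<Rightarrow> 'l) \<Rightarrow>
   ('k \<Rightarrow> 'e::ab_group_add \<Rightarrow> 'e) \<Rightarrow> 'e set \<Rightarrow> ('e \<times> 'e \<Rightarrow> 'e) \<Rightarrow> ('l, 'e) local_system set"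
  where "local_crossed_systems sL brL sE V br =
    {(lhd, rhd, f). (lhd, rhd, f, br) \<in> crossed_systems sL brL sE V}"

definition local_system_rel ::
  "('k::field \<Rightarrow> 'l::ab_group_add \<Rightarrow> 'l) \<Rightarrow> ('l \<times> 'l \<Rightarrow> 'l) \<Rightarrow>
   ('k \<Rightarrow> 'e::ab_group_add \<Rightarrow> 'e) \<Rightarrow> 'e set \<Rightarrow> ('e \<times> 'e \<Rightarrow> 'e) \<Rightarrow> ('l, 'e) local_system rel"
  where "local_system_rel sL brL sE V br = {(c, c').
    c \<in> local_crossed_systems sL brL sE V br \<and>
    c' \<in> local_crossed_systems sL brL sE V br \<and>
    (\<exists>r. Vector_Spaces.linear sL sE r \<and> range r \<subseteq> V \<and> cohomologous_via brL V br r c c')}"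

definition HL2 ::
  "('k::field \<Rightarrow> 'l::ab_group_add \<Rightarrow> 'l) \<Rightarrow> ('l \<times> 'l \<Rightarrow> 'l) \<Rightarrow>
   ('k \<Rightarrow> 'e::ab_group_add \<Rightarrow> 'e) \<Rightarrow> 'e set \<Rightarrow> ('e \<times> 'e \<Rightarrow> 'e) \<Rightarrow> ('l, 'e) local_system set set"
  where "HL2 sL brL sE V br =
    local_crossed_systems sL brL sE V br // local_system_rel sL brL sE V br"

text \<open>Both relations are equivalence relations, so that the quotients above are meaningful.\<close>

lemma bilinear_on_add:
  assumes "bilinear_on sa A sb B sc C m"
  shows "a \<in> A \<Longrightarrow> a' \<in> A \<Longrightarrow> b \<in> B \<Longrightarrow> m (a + a', b) = m (a, b) + m (a', b)"
    and "a \<in> A \<Longrightarrow> b \<in> B \<Longrightarrow> b' \<in> B \<Longrightarrow> m (a, b + b') = m (a, b) + m (a, b')"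
  using assms unfolding bilinear_on_def by blast+

lemma bilinear_on_minus:
  assumes m: "bilinear_on sa A sb B sc C m"
    and A: "module sa" "module.subspace sa A" and B: "module sb" "module.subspace sb B"
  shows "a \<in> A \<Longrightarrow> b \<in> B \<Longrightarrow> m (- a, b) = - m (a, b)"
    and "a \<in> A \<Longrightarrow> b \<in> B \<Longrightarrow> m (a, - b) = - m (a, b)"
    and "b \<in> B \<Longrightarrow> m (0, b) = 0"
    and "a \<in> A \<Longrightarrow> m (a, 0) = 0"
proof -
  have 0: "0 \<in> A" "0 \<in> B" and neg: "x \<in> A \<Longrightarrow> - x \<in> A" "y \<in> B \<Longrightarrow> - y \<in> B" for x y
    using A B by (simp_all add: module.subspace_0 module.subspace_neg)
  show z1: "m (0, b) = 0" if "b \<in> B" for b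
    using bilinear_on_add(1)[OF m 0(1) 0(1) that] by simp
  show z2: "m (a, 0) = 0" if "a \<in> A" for a
    using bilinear_on_add(2)[OF m that 0(2) 0(2)] by simp
  show "m (- a, b) = - m (a, b)" if "a \<in> A" "b \<in> B"
    using bilinear_on_add(1)[OF m neg(1)[OF that(1)] that] z1[OF that(2)]
    by (simp add: eq_neg_iff_add_eq_0)
  show "m (a, - b) = - m (a, b)" if "a \<in> A" "b \<in> B"
    using bilinear_on_add(2)[OF m that(1) neg(2)[OF that(2)] that(2)] z2[OF that(1)]
    by (simp add: eq_neg_iff_add_eq_0)
qed

lemma equiv_local_system_rel:
  assumes L: "vector_space sL" and E: "vector_space sE" and V: "module.subspace sE V"
  shows "equiv (local_crossed_systems sL brL sE V br) (local_system_rel sL brL sE V br)"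
proof (rule equivI)
  let ?S = "local_crossed_systems sL brL sE V br" and ?R = "local_system_rel sL brL sE V br"
  interpret vector_space_pair sL sE by (intro vector_space_pair.intro L E)
  note mE = vs2.module_axioms and V0 = vs2.subspace_0[OF V] and Vneg = vs2.subspace_neg[OF V]
  have bil: "bilinear_on sE V sL UNIV sE V lhd" "bilinear_on sL UNIV sE V sE V rhd"
      "bilinear_on sE V sE V sE V br" if "(lhd, rhd, f) \<in> ?S" for lhd rhd f
    using that by (auto simp: local_crossed_systems_def crossed_systems_def)
  note neg = bilinear_on_minus[OF bil(1) mE V vs1.module_axioms vs1.subspace_UNIV]
    bilinear_on_minus[OF bil(2) vs1.module_axioms vs1.subspace_UNIV mE V]
    bilinear_on_minus[OF bil(3) mE V mE V]
  note add = bilinear_on_add[OF bil(1)] bilinear_on_add[OF bil(2)] bilinear_on_add[OF bil(3)]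
  show "?R \<subseteq> ?S \<times> ?S"
    by (auto simp: local_system_rel_def)
  show "refl_on ?S ?R"
  proof (rule refl_onI)
    fix c assume c: "c \<in> ?S"
    obtain lhd rhd f where [simp]: "c = (lhd, rhd, f)" by (cases c)
    have "Vector_Spaces.linear sL sE (\<lambda>x. 0)" by (rule linear_zero)
    moreover have "cohomologous_via brL V br (\<lambda>x. 0) c c"
      using c V0 neg[of lhd rhd f] by (simp add: cohomologous_via_def)
    ultimately show "(c, c) \<in> ?R" using c V0 unfolding local_system_rel_def by blast
  qed
  show "sym ?R"
  proof (rule symI)
    fix c c' assume "(c, c') \<in> ?R"
    then obtain r where c: "c \<in> ?S" "c' \<in> ?S" and r: "Vector_Spaces.linear sL sE r"
      and rV: "range r \<subseteq> V" and rel: "cohomologous_via brL V br r c c'"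
      by (auto simp: local_system_rel_def)
    obtain lhd rhd f lhd' rhd' f' where [simp]: "c = (lhd, rhd, f)" "c' = (lhd', rhd', f')"
      by (cases c, cases c')
    have rV': "r x \<in> V" for x using rV by auto
    have "cohomologous_via brL V br (\<lambda>x. - r x) c' c"
      using rel c rV' neg[of lhd rhd f] neg[of lhd' rhd' f'] Vneg
      by (simp add: cohomologous_via_def)
    moreover have "Vector_Spaces.linear sL sE (\<lambda>x. - r x)" by (rule linear_compose_neg[OF r])
    moreover have "range (\<lambda>x. - r x) \<subseteq> V" using rV' Vneg by auto
    ultimately show "(c', c) \<in> ?R" using c unfolding local_system_rel_def by blast
  qed
  show "trans ?R"
  proof (rule transI)
    fix c c' c'' assume "(c, c') \<in> ?R" "(c', c'') \<in> ?R"
    then obtain r r' where c: "c \<in> ?S" "c' \<in> ?S" "c'' \<in> ?S"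
      and r: "Vector_Spaces.linear sL sE r" and rV: "range r \<subseteq> V"
      and r': "Vector_Spaces.linear sL sE r'" and r'V: "range r' \<subseteq> V"
      and rel: "cohomologous_via brL V br r c c'" "cohomologous_via brL V br r' c' c''"
      by (auto simp: local_system_rel_def)
    obtain lhd rhd f lhd' rhd' f' lhd'' rhd'' f''
      where [simp]: "c = (lhd, rhd, f)" "c' = (lhd', rhd', f')" "c'' = (lhd'', rhd'', f'')"
      by (cases c, cases c', cases c'')
    have rV': "r x \<in> V" "r' x \<in> V" for x using rV r'V by auto
    have rel1: "\<And>g x. g \<in> V \<Longrightarrow> lhd (g, x) = lhd' (g, x) + br (g, r x)"
        "\<And>g x. g \<in> V \<Longrightarrow> rhd (x, g) = rhd' (x, g) + br (r x, g)"
        "\<And>x y. f (x, y) =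
          f' (x, y) + br (r x, r y) - r (brL (x, y)) + rhd' (x, r y) + lhd' (r x, y)"
      and rel2: "\<And>g x. g \<in> V \<Longrightarrow> lhd' (g, x) = lhd'' (g, x) + br (g, r' x)"
        "\<And>g x. g \<in> V \<Longrightarrow> rhd' (x, g) = rhd'' (x, g) + br (r' x, g)"
        "\<And>x y. f' (x, y) =
          f'' (x, y) + br (r' x, r' y) - r' (brL (x, y)) + rhd'' (x, r' y) + lhd'' (r' x, y)"
      using rel by (auto simp: cohomologous_via_def)
    have adds: "lhd'' (r x + r' x, y) = lhd'' (r x, y) + lhd'' (r' x, y)"
        "rhd'' (x, r y + r' y) = rhd'' (x, r y) + rhd'' (x, r' y)"
        "g \<in> V \<Longrightarrow> br (r x + r' x, g) = br (r x, g) + br (r' x, g)"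
        "g \<in> V \<Longrightarrow> br (g, r x + r' x) = br (g, r x) + br (g, r' x)" for x y g
      using add[of lhd'' rhd'' f''] c(3) rV' by simp_all
    have "cohomologous_via brL V br (\<lambda>x. r x + r' x) c c''"
      using rV' vs2.subspace_add[OF V]
      by (simp add: cohomologous_via_def rel1 rel2 adds)
    moreover have "Vector_Spaces.linear sL sE (\<lambda>x. r x + r' x)"
      by (rule linear_compose_add[OF r r'])
    moreover have "range (\<lambda>x. r x + r' x) \<subseteq> V" using rV' vs2.subspace_add[OF V] by auto
    ultimately show "(c, c'') \<in> ?R" using c unfolding local_system_rel_def by blast
  qed
qed

lemma system_rel_iff:
  "((lhd, rhd, f, br), (lhd', rhd', f', br')) \<in> system_rel sL brL sE V \<longleftrightarrow>
   br = br' \<and> ((lhd, rhd, f), (lhd', rhd', f')) \<in> local_system_rel sL brL sE V br"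
  by (auto simp: system_rel_def local_system_rel_def local_crossed_systems_def)

lemma equiv_system_rel:
  assumes "vector_space sL" and "vector_space sE" and "module.subspace sE V"
  shows "equiv (crossed_systems sL brL sE V) (system_rel sL brL sE V)"
proof -
  note eq = equiv_local_system_rel[OF assms, of brL]
  show ?thesis
  proof (rule equivI)
    show "system_rel sL brL sE V \<subseteq> crossed_systems sL brL sE V \<times> crossed_systems sL brL sE V"
      by (auto simp: system_rel_def)
    show "refl_on (crossed_systems sL brL sE V) (system_rel sL brL sE V)"
    proof (rule refl_onI)
      fix c assume "c \<in> crossed_systems sL brL sE V"
      then show "(c, c) \<in> system_rel sL brL sE V"
        by (cases c) (auto simp: system_rel_iff local_crossed_systems_def
            intro!: equiv_class_self[OF eq, unfolded Image_singleton_iff])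
    qed
    show "sym (system_rel sL brL sE V)"
      using eq by (auto simp: sym_def system_rel_iff equiv_def)
    show "trans (system_rel sL brL sE V)"
      using eq unfolding trans_def equiv_def by (simp add: system_rel_iff)
  qed
qed

end

theory Submission
  imports Defs
begin

text \<open>
  The bracket on \<open>\<gg>\<close> is an invariant of a \<open>\<approx>\<close>-class, and on crossed systems with a fixed bracket
  \<open>\<approx>\<close> is \<open>\<approx>\<^sub>l\<close>.  The bracket on \<open>\<gg>\<close> of a crossed system satisfies the Leibniz identity because the
  crossed bracket restricts to it on \<open>\<gg> \<times> 0\<close>.
\<close>

lemma crossed_bracket_pair:
  "g \<in> V \<Longrightarrow> h \<in> V \<Longrightarrow> crossed_bracket brL V (lhd, rhd, f, br) ((g, x), (h, y)) =
    (br (g, h) + rhd (x, h) + lhd (g, y) + f (x, y), brL (x, y))"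
  by (simp add: crossed_bracket_def)

lemma leibniz_algebra_on_if_crossed_system:
  assumes L: "leibniz_algebra_on sL UNIV brL"
    and E: "vector_space sE" and V: "module.subspace sE V"
    and c: "(lhd, rhd, f, br) \<in> crossed_systems sL brL sE V"
  shows "leibniz_algebra_on sE V br"
proof -
  interpret L: vector_space sL using L by (simp add: leibniz_algebra_on_def)
  interpret E: vector_space sE by (rule E)
  note mL = L.module_axioms and mE = E.module_axioms
  have "bilinear_on sL UNIV sL UNIV sL UNIV brL"
    using L by (simp add: leibniz_algebra_on_def)
  then have brL0: "brL (0, 0) = 0"
    by (rule bilinear_on_minus(3)[OF _ mL L.subspace_UNIV mL L.subspace_UNIV UNIV_I])
  have bil: "bilinear_on sE V sL UNIV sE V lhd" "bilinear_on sL UNIV sE V sE V rhd"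
      "bilinear_on sL UNIV sL UNIV sE V f" and br: "bilinear_on sE V sE V sE V br"
    and lb: "leibniz_algebra_on (module_prod.scale sE sL) (V \<times> UNIV)
      (crossed_bracket brL V (lhd, rhd, f, br))"
    using c by (auto simp: crossed_systems_def)
  let ?B = "crossed_bracket brL V (lhd, rhd, f, br)"
  \<comment> \<open>The actions and the cocycle \<open>f\<close> vanish here by bilinearity, as each
    gets a zero argument.\<close>
  have B: "?B ((g, 0), (h, 0)) = (br (g, h), 0)" if "g \<in> V" "h \<in> V" for g h
    using that brL0 bilinear_on_minus(4)[OF bil(1) mE V mL L.subspace_UNIV]
      bilinear_on_minus(3)[OF bil(2) mL L.subspace_UNIV mE V]
      bilinear_on_minus(3)[OF bil(3) mL L.subspace_UNIV mL L.subspace_UNIV]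
    by (simp add: crossed_bracket_pair)
  have brV: "br (g, h) \<in> V" if "g \<in> V" "h \<in> V" for g h
    using br that by (auto simp: bilinear_on_def)
  have "br (x, br (y, z)) = br (br (x, y), z) - br (br (x, z), y)"
    if xyz: "x \<in> V" "y \<in> V" "z \<in> V" for x y z
  proof -
    have "\<forall>u\<in>V \<times> UNIV. \<forall>v\<in>V \<times> UNIV. \<forall>w\<in>V \<times> UNIV.
        ?B (u, ?B (v, w)) = ?B (?B (u, v), w) - ?B (?B (u, w), v)"
      using lb unfolding leibniz_algebra_on_def by blast
    then have "?B ((x, 0), ?B ((y, 0), (z, 0))) =
        ?B (?B ((x, 0), (y, 0)), (z, 0)) - ?B (?B ((x, 0), (z, 0)), (y, 0))"
      using xyz by blast
    \<comment> \<open>By \<open>brV\<close> the inner brackets lie in \<open>V \<times> {0}\<close>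
      again, so \<open>B\<close> applies twice and the first components give the claim.\<close>
    then show ?thesis using xyz brV by (simp add: B)
  qed
  with E V br show ?thesis by (simp add: leibniz_algebra_on_def)
qed

text \<open>The canonical identification on representatives. Its image map on classes will be the
  bijection, so well-definedness needs no choice of representative.\<close>

definition with_bracket :: "('e \<times> 'e \<Rightarrow> 'e) \<Rightarrow> ('l, 'e) local_system \<Rightarrow> ('l, 'e) system"
  where "with_bracket br = (\<lambda>(lhd, rhd, f). (lhd, rhd, f, br))"

lemma with_bracket_eq_iff [simp]:
  "with_bracket br c = with_bracket br' c' \<longleftrightarrow> br = br' \<and> c = c'"
  by (auto simp: with_bracket_def split: prod.splits)

text \<open>Related systems share their bracket, so everything in the class of a system carries the
  same \<open>br\<close>. If \<open>c\<close> is not a local crossed system for \<open>br\<close>,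
  both sides are empty.\<close>

lemma system_rel_class:
  "system_rel sL brL sE V `` {with_bracket br c} =
    with_bracket br ` (local_system_rel sL brL sE V br `` {c})"
proof -
  obtain lhd rhd f where "c = (lhd, rhd, f)" by (cases c)
  then show ?thesis
    by (force simp: with_bracket_def system_rel_iff)
qed

text \<open>The bracket of a crossed system is a Leibniz structure, so indexing by such structures
  loses no system.\<close>

lemma crossed_systems_eq_Union:
  assumes "leibniz_algebra_on sL UNIV brL" "vector_space sE" "module.subspace sE V"
  shows "crossed_systems sL brL sE V =
    (\<Union>br\<in>{br. leibniz_algebra_on sE V br}. with_bracket br ` local_crossed_systems sL brL sE V br)"
  using leibniz_algebra_on_if_crossed_system[OF assms]
  by (force simp: local_crossed_systems_def with_bracket_def)

lemma bij_betw_HL2_GHL2: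
  assumes L: "leibniz_algebra_on sL UNIV brL"
    and E: "vector_space sE" and V: "module.subspace sE V"
  shows "bij_betw (\<lambda>(br, C). with_bracket br ` C)
    (SIGMA br : {br. leibniz_algebra_on sE V br}. HL2 sL brL sE V br) (GHL2 sL brL sE V)"
proof (rule bij_betw_imageI)
  have "vector_space sL" using L by (simp add: leibniz_algebra_on_def)
  note eq = equiv_local_system_rel[OF this E V, of brL]
  \<comment> \<open>The bracket is recovered from an element of the image. The empty set would have
    the same image under every \<open>br\<close>.\<close>
  have ne: "C \<noteq> {}" if "C \<in> HL2 sL brL sE V br" for br C
    using in_quotient_imp_non_empty[OF eq] that by (auto simp: HL2_def)
  show "inj_on (\<lambda>(br, C). with_bracket br ` C)
      (SIGMA br : {br. leibniz_algebra_on sE V br}. HL2 sL brL sE V br)"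
  proof (rule inj_onI, clarify)
    fix br C br' C'
    assume C: "C \<in> HL2 sL brL sE V br"
      and im: "with_bracket br ` C = with_bracket br' ` C'"
    obtain c where "c \<in> C" using ne[OF C] by blast
    then have "with_bracket br c \<in> with_bracket br' ` C'" using im by blast
    then have "br = br'" by auto
    with im show "br = br' \<and> C = C'" by (simp add: inj_image_eq_iff inj_def)
  qed
  show "(\<lambda>(br, C). with_bracket br ` C) `
      (SIGMA br : {br. leibniz_algebra_on sE V br}. HL2 sL brL sE V br) = GHL2 sL brL sE V"
    \<comment> \<open>After splitting the crossed systems by bracket, both sides collect the same
      classes, matched by \<open>system_rel_class\<close>.\<close>
    unfolding GHL2_def HL2_def quotient_def crossed_systems_eq_Union[OF L E V]
    by (simp add: system_rel_class image_Union image_UN image_image Sigma_def) blast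
qed

theorem corollary2p6:
  fixes sL :: "'k::field \<Rightarrow> 'l::ab_group_add \<Rightarrow> 'l"
    and brL :: "'l \<times> 'l \<Rightarrow> 'l"
    and sE :: "'k \<Rightarrow> 'e::ab_group_add \<Rightarrow> 'e"
    and \<pi> :: "'e \<Rightarrow> 'l"
    and \<gg> :: "'e set"
  assumes "leibniz_algebra_on sL UNIV brL"
    and "vector_space sE"
    and "Vector_Spaces.linear sE sL \<pi>"
    and "surj \<pi>"
    and "\<gg> = {e. \<pi> e = 0}"
  shows "\<exists>\<Phi>.
    bij_betw \<Phi>
      (SIGMA br : {br. leibniz_algebra_on sE \<gg> br}. HL2 sL brL sE \<gg> br)
      (GHL2 sL brL sE \<gg>) \<and>
    (\<forall>br lhd rhd f. leibniz_algebra_on sE \<gg> br \<longrightarrow>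
      (lhd, rhd, f) \<in> local_crossed_systems sL brL sE \<gg> br \<longrightarrow>
      \<Phi> (br, local_system_rel sL brL sE \<gg> br `` {(lhd, rhd, f)}) =
        system_rel sL brL sE \<gg> `` {(lhd, rhd, f, br)})"
proof (intro exI conjI allI impI)
  interpret Vector_Spaces.linear sE sL \<pi> by (rule assms(3))
  have "module.subspace sE \<gg>"
    unfolding assms(5) by (rule subspace_kernel)
  with assms(1,2) show "bij_betw (\<lambda>(br, C). with_bracket br ` C)
      (SIGMA br : {br. leibniz_algebra_on sE \<gg> br}. HL2 sL brL sE \<gg> br) (GHL2 sL brL sE \<gg>)"
    by (rule bij_betw_HL2_GHL2)
  \<comment> \<open>This says that the bijection is the canonical one: its value on a local class is
    the class of the completed quadruple.\<close>
  show "(\<lambda>(br, C). with_bracket br ` C) (br, local_system_rel sL brL sE \<gg> br `` {(lhd, rhd, f)}) =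
      system_rel sL brL sE \<gg> `` {(lhd, rhd, f, br)}" for br lhd rhd f
    using system_rel_class[of sL brL sE \<gg> br "(lhd, rhd, f)"] by (simp add: with_bracket_def)
qed

end
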